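(* Let $\varphi_1,\varphi_2,\psi_1,\psi_2$ be positive functions from $C_0^+[0,1]$. Define the Lyapunov operator $\mathcal{L}$ on $C[0,1]$ by $$(\mathcal{L}f)(t)=\int_0^1\!\!\int_0^1\bigl(\psi_1(t)\varphi_1(u)+\psi_2(t)\varphi_2(v)\bigr)f(u)f(v)\,du\,dv,$$ and the quadratic operator $P:\mathbb{R}^2\to\mathbb{R}^2$ by $$P(x,y)=\bigl(\alpha_{11}x^2+\alpha_{12}xy+\alpha_{22}y^2,\ \beta_{11}x^2+\beta_{12}xy+\beta_{22}y^2\bigr),$$ where $$\alpha_{11}=\int_0^1\!\!\int_0^1\psi_1(u)\psi_1(v)\varphi_2(v)\,du\,dv,\quad \alpha_{12}=\int_0^1\!\!\int_0^1\bigl(\psi_1(v)\psi_2(u)+\psi_1(u)\psi_2(v)\bigr)\varphi_2(v)\,du\,dv,$$ $$\alpha_{22}=\int_0^1\!\!\int_0^1\psi_2(u)\psi_2(v)\varphi_2(v)\,du\,dv,\quad \beta_{11}=\int_0^1\!\!\int_0^1\psi_1(u)\psi_1(v)\varphi_1(u)\,du\,dv,$$ $$\beta_{12}=\int_0^1\!\!\int_0^1\bigl(\psi_1(u)\psi_2(v)+\psi_1(v)\psi_2(u)\bigr)\varphi_1(u)\,du\,dv,\quad \beta_{22}=\int_0^1\!\!\int_0^1\psi_2(u)\psi_2(v)\varphi_1(u)\,du\,dv.$$ Then $\mathcal{L}$ has a nontrivial positive fixed point if and only if $P$ has a nontrivial positive fixed point; moreover $N_{fix}^{+}(\mathcal{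L})=N_{fix}^{+}(P)$.
   Context: $C^+[0,1]=\{f\in C[0,1]: f(t)\ge 0 \text{ for all } t\in[0,1]\}$ is called the cone of positive continuous functions on $[0,1]$, and $C_0^+[0,1]=C^+[0,1]\setminus\{0\}$. A nontrivial positive fixed point of $\mathcal{L}$ is a function $f\in C_0^+[0,1]$ with $\mathcal{L}f=f$. A nontrivial positive fixed point of $P$ is a point $(x,y)\in\mathbb{R}^2$ with $x\ge0$, $y\ge0$, $(x,y)\neq(0,0)$ and $P(x,y)=(x,y)$. $N_{fix}^{+}(\cdot)$ denotes the number of nontrivial positive fixed points of the given operator. *)

theory Defs
  imports "HOL-Analysis.Analysis" "HOL-Library.FuncSet" "HOL-Library.Equipollence"
begin

text \<open>
  Elements of \<open>C[0,1]\<close> are represented by their extensional representatives (equal to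
  \<^const>\<open>undefined\<close> outside \<open>{0..1}\<close>), so that equality of HOL functions is equality on
  \<open>[0,1]\<close> and counting such functions is meaningful.
\<close>

definition C01 :: "(real \<Rightarrow> real) set" where
  "C01 = {f \<in> extensional {0..1}. continuous_on {0..1} f}"

definition C01_plus :: "(real \<Rightarrow> real) set" where
  "C01_plus = {f \<in> C01. \<forall>t\<in>{0..1}. 0 \<le> f t}"

definition C01_plus0 :: "(real \<Rightarrow> real) set" where
  "C01_plus0 = C01_plus - {\<lambda>t\<in>{0..1}. 0}"

definition R2_plus0 :: "(real \<times> real) set" where
  "R2_plus0 = {(x, y). 0 \<le> x \<and> 0 \<le> y \<and> (x, y) \<noteq> (0, 0)}"

text \<open>
  Numbers of fixed points are compared by equipollence (\<open>\<approx>\<close>) of these sets rather than by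
  \<^const>\<open>card\<close>, which would identify infinite sets with the empty set.
\<close>

definition fixed_points :: "'a set \<Rightarrow> ('a \<Rightarrow> 'a) \<Rightarrow> 'a set" where
  "fixed_points K T = {x \<in> K. T x = x}"

text \<open>The inner integration is over the first argument of the integrand (\<open>du dv\<close>).\<close>

definition dint :: "(real \<Rightarrow> real \<Rightarrow> real) \<Rightarrow> real" where
  "dint g = integral {0..1} (\<lambda>v. integral {0..1} (\<lambda>u. g u v))"

definition lyapunov_op ::
  "(real \<Rightarrow> real) \<Rightarrow> (real \<Rightarrow> real) \<Rightarrow> (real \<Rightarrow> real) \<Rightarrow> (real \<Rightarrow> real) \<Rightarrow> (real \<Rightarrow> real) \<Rightarrow> (real \<Rightarrow> real)"
  where
  "lyapunov_op \<phi>\<^sub>1 \<phi>\<^sub>2 \<psi>\<^sub>1 \<psi>\<^sub>2 f =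
     (\<lambda>t\<in>{0..1}. dint (\<lambda>u v. (\<psi>\<^sub>1 t * \<phi>\<^sub>1 u + \<psi>\<^sub>2 t * \<phi>\<^sub>2 v) * f u * f v))"

text \<open>
  Pitfall: for a fixed point \<open>x \<psi>\<^sub>1 + y \<psi>\<^sub>2\<close> of \<open>lyapunov_op\<close>, the coefficient \<open>x\<close> is given
  by the \<open>\<beta>\<close>-form (with weight \<open>\<phi>\<^sub>1\<close>) and \<open>y\<close> by the \<open>\<alpha>\<close>-form (with weight \<open>\<phi>\<^sub>2\<close>),
  whereas the components of \<open>quadratic_op\<close> come in the order \<open>(\<alpha>, \<beta>)\<close>.
\<close>

definition quadratic_op ::
  "(real \<Rightarrow> real) \<Rightarrow> (real \<Rightarrow> real) \<Rightarrow> (real \<Rightarrow> real) \<Rightarrow> (real \<Rightarrow> real) \<Rightarrow> real \<times> real \<Rightarrow> real \<times> real"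
  where
  "quadratic_op \<phi>\<^sub>1 \<phi>\<^sub>2 \<psi>\<^sub>1 \<psi>\<^sub>2 = (\<lambda>(x, y).
     let \<alpha>\<^sub>1\<^sub>1 = dint (\<lambda>u v. \<psi>\<^sub>1 u * \<psi>\<^sub>1 v * \<phi>\<^sub>2 v);
         \<alpha>\<^sub>1\<^sub>2 = dint (\<lambda>u v. (\<psi>\<^sub>1 v * \<psi>\<^sub>2 u + \<psi>\<^sub>1 u * \<psi>\<^sub>2 v) * \<phi>\<^sub>2 v);
         \<alpha>\<^sub>2\<^sub>2 = dint (\<lambda>u v. \<psi>\<^sub>2 u * \<psi>\<^sub>2 v * \<phi>\<^sub>2 v);
         \<beta>\<^sub>1\<^sub>1 = dint (\<lambda>u v. \<psi>\<^sub>1 u * \<psi>\<^sub>1 v * \<phi>\<^sub>1 u);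
         \<beta>\<^sub>1\<^sub>2 = dint (\<lambda>u v. (\<psi>\<^sub>1 u * \<psi>\<^sub>2 v + \<psi>\<^sub>1 v * \<psi>\<^sub>2 u) * \<phi>\<^sub>1 u);
         \<beta>\<^sub>2\<^sub>2 = dint (\<lambda>u v. \<psi>\<^sub>2 u * \<psi>\<^sub>2 v * \<phi>\<^sub>1 u)
     in (\<alpha>\<^sub>1\<^sub>1 * x\<^sup>2 + \<alpha>\<^sub>1\<^sub>2 * x * y + \<alpha>\<^sub>2\<^sub>2 * y\<^sup>2,
         \<beta>\<^sub>1\<^sub>1 * x\<^sup>2 + \<beta>\<^sub>1\<^sub>2 * x * y + \<beta>\<^sub>2\<^sub>2 * y\<^sup>2))"

end

theory Submission
  imports Defs
begin

text \<open>
  The integrals factor: with \<open>I g = \<integral>g\<close>, a fixed point of the Lyapunov operator satisfies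
  \<open>f = I f \<cdot> (I (\<phi>\<^sub>1 f) \<psi>\<^sub>1 + I (\<phi>\<^sub>2 f) \<psi>\<^sub>2)\<close>, so \<open>f = x \<psi>\<^sub>1 + y \<psi>\<^sub>2\<close> where \<open>(x, y)\<close> is
  a fixed point of \<open>P\<close> \<^emph>\<open>with its two components interchanged\<close>. Interchanging the components does
  not preserve fixed points, so this correspondence alone does not give the theorem. However,
  \<open>P\<close> and its interchanged version are both of the form \<open>p \<mapsto> (a \<bullet> p) M p\<close> with a positive vector
  \<open>a\<close> and a positive \<open>2 \<times> 2\<close> matrix \<open>M\<close>. A fixed point of such a map is a positive eigenvector of
  \<open>M\<close> (unique up to scaling, by Perron), with the scale determined by \<open>a\<close>. Hence all
  these operators have exactly one nontrivial positive fixed point.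
\<close>

section \<open>Fixed points of a positive linear form times a positive linear map of the
  plane\<close>

text \<open>The equation says that \<open>(1, r)\<close> is an eigenvector of the matrix with rows
  \<open>(p\<^sub>1, p\<^sub>2)\<close> and \<open>(q\<^sub>1, q\<^sub>2)\<close>. As a quadratic in
  \<open>r\<close> it has positive leading coefficient and negative constant term, hence exactly one
  positive root.\<close>

lemma ex1_positive_eigendirection:
  fixes p\<^sub>1 p\<^sub>2 q\<^sub>1 q\<^sub>2 :: real
  assumes "0 < p\<^sub>2" "0 < q\<^sub>1"
  shows "\<exists>!r. 0 < r \<and> r * (p\<^sub>1 + p\<^sub>2 * r) = q\<^sub>1 + q\<^sub>2 * r"
proof (rule ex_ex1I)
  \<comment> \<open>The square root of the discriminant; \<open>r\<close> is then the larger root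
    given by the quadratic formula, and it is positive because \<open>d\<close> exceeds the absolute
    value of the linear coefficient.\<close>
  define d where "d = sqrt ((q\<^sub>2 - p\<^sub>1)\<^sup>2 + 4 * p\<^sub>2 * q\<^sub>1)"
  define r where "r = (q\<^sub>2 - p\<^sub>1 + d) / (2 * p\<^sub>2)"
  have d2: "d\<^sup>2 = (q\<^sub>2 - p\<^sub>1)\<^sup>2 + 4 * p\<^sub>2 * q\<^sub>1"
    unfolding d_def using assms by simp
  have "\<bar>q\<^sub>2 - p\<^sub>1\<bar> < d"
    unfolding d_def by (rule real_less_rsqrt) (use assms in simp)
  then have "0 < r"
    unfolding r_def using assms by simp
  moreover have d: "d = 2 * p\<^sub>2 * r - (q\<^sub>2 - p\<^sub>1)"
    unfolding r_def using assms by simp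
  have "4 * p\<^sub>2 * (r * (p\<^sub>1 + p\<^sub>2 * r)) = 4 * p\<^sub>2 * (q\<^sub>1 + q\<^sub>2 * r)"
    using d2 unfolding d by (simp add: power2_eq_square algebra_simps)
  then have "r * (p\<^sub>1 + p\<^sub>2 * r) = q\<^sub>1 + q\<^sub>2 * r"
    using assms by simp
  ultimately show "\<exists>r. 0 < r \<and> r * (p\<^sub>1 + p\<^sub>2 * r) = q\<^sub>1 + q\<^sub>2 * r"
    by blast
next
  fix r s
  assume r: "0 < r \<and> r * (p\<^sub>1 + p\<^sub>2 * r) = q\<^sub>1 + q\<^sub>2 * r"
    and s: "0 < s \<and> s * (p\<^sub>1 + p\<^sub>2 * s) = q\<^sub>1 + q\<^sub>2 * s"
  \<comment> \<open>by Vieta, the product of the two roots is negative\<close>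
  have "(r - s) * (p\<^sub>2 * r * s + q\<^sub>1) = s * (r * (p\<^sub>1 + p\<^sub>2 * r) - (q\<^sub>1 + q\<^sub>2 * r))
      - r * (s * (p\<^sub>1 + p\<^sub>2 * s) - (q\<^sub>1 + q\<^sub>2 * s))"
    by (simp add: algebra_simps)
  then have "(r - s) * (p\<^sub>2 * r * s + q\<^sub>1) = 0"
    using r s by simp
  moreover have "0 < p\<^sub>2 * r * s + q\<^sub>1"
    using r s assms by (simp add: add_pos_pos)
  ultimately show "r = s"
    by simp
qed

text \<open>A fixed point must lie on the unique positive eigendirection. On that ray the map is
  quadratic in the scale, which leaves a single nonzero scale.\<close>

lemma ex1_fixed_point_linear_product:
  fixes a\<^sub>1 a\<^sub>2 p\<^sub>1 p\<^sub>2 q\<^sub>1 q\<^sub>2 :: real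
  assumes pos: "0 < a\<^sub>1" "0 < a\<^sub>2" "0 < p\<^sub>1" "0 < p\<^sub>2" "0 < q\<^sub>1" "0 < q\<^sub>2"
  shows "\<exists>!z. z \<in> R2_plus0 \<and>
    (case z of (x, y) \<Rightarrow> ((a\<^sub>1 * x + a\<^sub>2 * y) * (p\<^sub>1 * x + p\<^sub>2 * y),
      (a\<^sub>1 * x + a\<^sub>2 * y) * (q\<^sub>1 * x + q\<^sub>2 * y))) = z"
proof -
  obtain r where r: "0 < r" "r * (p\<^sub>1 + p\<^sub>2 * r) = q\<^sub>1 + q\<^sub>2 * r"
    and unique: "\<And>s. 0 < s \<Longrightarrow> s * (p\<^sub>1 + p\<^sub>2 * s) = q\<^sub>1 + q\<^sub>2 * s \<Longrightarrow> s = r"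
    using ex1_positive_eigendirection[OF pos(4) pos(5)] by metis
  \<comment> \<open>The map sends \<open>(1, r)\<close> to \<open>(c, r * c)\<close>. Being
    homogeneous of degree 2, it fixes a nonzero multiple of \<open>(1, r)\<close> exactly when the
    scale is \<open>1 / c\<close>.\<close>
  define c where "c = (a\<^sub>1 + a\<^sub>2 * r) * (p\<^sub>1 + p\<^sub>2 * r)"
  have c: "0 < c"
    unfolding c_def using pos r by (simp add: add_pos_pos)
  show ?thesis
  proof (rule ex1I[of _ "(1 / c, r / c)"], intro conjI)
    show "(1 / c, r / c) \<in> R2_plus0"
      using c r by (simp add: R2_plus0_def)
    have "(a\<^sub>1 * (1 / c) + a\<^sub>2 * (r / c)) * (p\<^sub>1 * (1 / c) + p\<^sub>2 * (r / c)) = c / (c * c)"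
      by (subst (5) c_def) (simp add: add_divide_distrib[symmetric])
    moreover have "(a\<^sub>1 * (1 / c) + a\<^sub>2 * (r / c)) * (q\<^sub>1 * (1 / c) + q\<^sub>2 * (r / c))
        = (a\<^sub>1 + a\<^sub>2 * r) * (q\<^sub>1 + q\<^sub>2 * r) / (c * c)"
      by (simp add: add_divide_distrib[symmetric])
    moreover have "(a\<^sub>1 + a\<^sub>2 * r) * (q\<^sub>1 + q\<^sub>2 * r) = r * c"
      unfolding c_def r(2)[symmetric] by simp
    ultimately show "(case (1 / c, r / c) of (x, y) \<Rightarrow>
        ((a\<^sub>1 * x + a\<^sub>2 * y) * (p\<^sub>1 * x + p\<^sub>2 * y),
         (a\<^sub>1 * x + a\<^sub>2 * y) * (q\<^sub>1 * x + q\<^sub>2 * y))) = (1 / c, r / c)"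
      using c by simp
  next
    fix z :: "real \<times> real"
    assume z: "z \<in> R2_plus0 \<and>
      (case z of (x, y) \<Rightarrow> ((a\<^sub>1 * x + a\<^sub>2 * y) * (p\<^sub>1 * x + p\<^sub>2 * y),
        (a\<^sub>1 * x + a\<^sub>2 * y) * (q\<^sub>1 * x + q\<^sub>2 * y))) = z"
    obtain x y where xy: "z = (x, y)"
      by force
    define A where "A = a\<^sub>1 * x + a\<^sub>2 * y"
    have nn: "0 \<le> x" "0 \<le> y" "0 < x \<or> 0 < y"
      and eq: "x = A * (p\<^sub>1 * x + p\<^sub>2 * y)" "y = A * (q\<^sub>1 * x + q\<^sub>2 * y)"
      using z unfolding xy R2_plus0_def A_def by auto
    \<comment> \<open>A linear form with positive coefficients is positive on the quadrant without
      the origin; this forces both coordinates of a fixed point to be positive.\<close>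
    have lin: "0 < b * x + b' * y" if "0 < b" "0 < b'" for b b'
      using nn that by (auto intro: add_pos_nonneg add_nonneg_pos)
    have A: "0 < A"
      unfolding A_def by (rule lin) (use pos in auto)
    have x: "0 < x"
      by (subst eq(1)) (use A lin pos in simp)
    have y: "0 < y"
      by (subst eq(2)) (use A lin pos in simp)
    \<comment> \<open>The slope of \<open>z\<close>. Eliminating between the two fixed-point
      equations and cancelling \<open>A * x\<close> shows that it solves the eigendirection
      equation.\<close>
    define s where "s = y / x"
    have s: "0 < s" "y = s * x"
      unfolding s_def using x y by auto
    have "(A * x) * (s * (p\<^sub>1 + p\<^sub>2 * s)) = s * (A * (p\<^sub>1 * x + p\<^sub>2 * y))"
      unfolding s(2) by (simp add: algebra_simps)
    also have "\<dots> = A * (q\<^sub>1 * x + q\<^sub>2 * y)"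
      using eq s(2) by simp
    also have "\<dots> = (A * x) * (q\<^sub>1 + q\<^sub>2 * s)"
      unfolding s(2) by (simp add: algebra_simps)
    finally have "s * (p\<^sub>1 + p\<^sub>2 * s) = q\<^sub>1 + q\<^sub>2 * s"
      using A x by simp
    then have "s = r"
      using unique s(1) by blast
    \<comment> \<open>With slope \<open>r\<close>, both linear factors of the first equation are
      multiples of \<open>x\<close>, and the product of their constants is \<open>c\<close>.\<close>
    have "x = x * (x * c)"
      by (subst (1) eq(1)) (simp add: A_def c_def s(2) \<open>s = r\<close> algebra_simps)
    then have "x = 1 / c"
      using x c by (simp add: field_simps)
    then show "z = (1 / c, r / c)"
      using s(2) \<open>s = r\<close> xy by simp
  qed
qed

section \<open>Separation of variables in the double integrals\<close>

abbreviation I01 :: "(real \<Rightarrow> real) \<Rightarrow> real" where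
  "I01 \<equiv> integral {0..1}"

text \<open>A continuous nonnegative function with zero integral vanishes identically.\<close>

lemma I01_pos:
  assumes "continuous_on {0..1} g" "\<And>t. t \<in> {0..1} \<Longrightarrow> 0 \<le> g t" "t \<in> {0..1}" "0 < g t"
  shows "0 < I01 g"
proof -
  have "0 \<le> I01 g"
    by (rule integral_nonneg) (use assms integrable_continuous_real in auto)
  moreover have "I01 g \<noteq> 0"
    using integral_eq_0_iff[of 0 1 g] assms by force
  ultimately show ?thesis
    by simp
qed

lemma dint_mult: "dint (\<lambda>u v. g u * h v) = I01 g * I01 h"
  unfolding dint_def by simp

lemma dint_mult_add:
  assumes "continuous_on {0..1} g" "continuous_on {0..1} h"
    "continuous_on {0..1} g'" "continuous_on {0..1} h'"
  shows "dint (\<lambda>u v. g u * h v + g' u * h' v) = I01 g * I01 h + I01 g' * I01 h'"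
proof -
  have "integral {0..1} (\<lambda>u. g u * h v + g' u * h' v) = I01 g * h v + I01 g' * h' v" for v
    by (subst integral_add)
      (auto intro!: integrable_continuous_real continuous_intros assms)
  then show ?thesis
    unfolding dint_def
    by simp (subst integral_add;
      auto intro!: integrable_continuous_real continuous_intros assms)
qed

text \<open>Each coefficient is a product, or a sum of two products, of single integrals. The
  monomials then regroup so that both components share the factor which is the integral of x \<psi>1
  + y \<psi>2.\<close>

lemma quadratic_op_eq:
  assumes "continuous_on {0..1} \<phi>\<^sub>1" "continuous_on {0..1} \<phi>\<^sub>2"
    "continuous_on {0..1} \<psi>\<^sub>1" "continuous_on {0..1} \<psi>\<^sub>2"
  shows "quadratic_op \<phi>\<^sub>1 \<phi>\<^sub>2 \<psi>\<^sub>1 \<psi>\<^sub>2 = (\<lambda>(x, y).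
    ((I01 \<psi>\<^sub>1 * x + I01 \<psi>\<^sub>2 * y) * (I01 (\<lambda>t. \<psi>\<^sub>1 t * \<phi>\<^sub>2 t) * x + I01 (\<lambda>t. \<psi>\<^sub>2 t * \<phi>\<^sub>2 t) * y),
     (I01 \<psi>\<^sub>1 * x + I01 \<psi>\<^sub>2 * y) * (I01 (\<lambda>t. \<psi>\<^sub>1 t * \<phi>\<^sub>1 t) * x + I01 (\<lambda>t. \<psi>\<^sub>2 t * \<phi>\<^sub>1 t) * y)))"
proof -
  \<comment> \<open>Stated for arbitrary \<open>f\<close> and \<open>g\<close> so as to cover the
    coefficients of both squares; likewise \<open>b11\<close>.\<close>
  have a11: "dint (\<lambda>u v. f u * g v * \<phi>\<^sub>2 v) = I01 f * I01 (\<lambda>t. g t * \<phi>\<^sub>2 t)" for f g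
    using dint_mult[of f "\<lambda>t. g t * \<phi>\<^sub>2 t"] by (simp add: mult.assoc)
  have b11: "dint (\<lambda>u v. f u * g v * \<phi>\<^sub>1 u) = I01 (\<lambda>t. f t * \<phi>\<^sub>1 t) * I01 g" for f g
    using dint_mult[of "\<lambda>t. f t * \<phi>\<^sub>1 t" g] by (simp add: mult_ac)
  have a12: "dint (\<lambda>u v. (\<psi>\<^sub>1 v * \<psi>\<^sub>2 u + \<psi>\<^sub>1 u * \<psi>\<^sub>2 v) * \<phi>\<^sub>2 v)
      = I01 \<psi>\<^sub>2 * I01 (\<lambda>t. \<psi>\<^sub>1 t * \<phi>\<^sub>2 t) + I01 \<psi>\<^sub>1 * I01 (\<lambda>t. \<psi>\<^sub>2 t * \<phi>\<^sub>2 t)"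
    by (subst dint_mult_add[symmetric])
      (auto intro!: continuous_intros assms simp: algebra_simps)
  have b12: "dint (\<lambda>u v. (\<psi>\<^sub>1 u * \<psi>\<^sub>2 v + \<psi>\<^sub>1 v * \<psi>\<^sub>2 u) * \<phi>\<^sub>1 u)
      = I01 (\<lambda>t. \<psi>\<^sub>1 t * \<phi>\<^sub>1 t) * I01 \<psi>\<^sub>2 + I01 (\<lambda>t. \<psi>\<^sub>2 t * \<phi>\<^sub>1 t) * I01 \<psi>\<^sub>1"
    by (subst dint_mult_add[symmetric])
      (auto intro!: continuous_intros assms simp: algebra_simps)
  show ?thesis
    unfolding quadratic_op_def Let_def a11 b11 a12 b12
    by (simp add: fun_eq_iff algebra_simps power2_eq_square)
qed

text \<open>Separating variables puts every image in the span of \<psi>1 and \<psi>2, so that the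
  fixed-point problem becomes one about two coefficients.\<close>

lemma lyapunov_op_eq:
  assumes "continuous_on {0..1} \<phi>\<^sub>1" "continuous_on {0..1} \<phi>\<^sub>2" "continuous_on {0..1} f"
  shows "lyapunov_op \<phi>\<^sub>1 \<phi>\<^sub>2 \<psi>\<^sub>1 \<psi>\<^sub>2 f =
    (\<lambda>t\<in>{0..1}. I01 f * I01 (\<lambda>t. f t * \<phi>\<^sub>1 t) * \<psi>\<^sub>1 t + I01 f * I01 (\<lambda>t. f t * \<phi>\<^sub>2 t) * \<psi>\<^sub>2 t)"
proof -
  \<comment> \<open>For fixed \<open>t\<close> the values of \<psi>1 and \<psi>2 are constants;
    attaching them to the factor in \<open>v\<close> gives the shape of
    \<open>dint_mult_add\<close>.\<close>
  have "(\<lambda>u v. (\<psi>\<^sub>1 t * \<phi>\<^sub>1 u + \<psi>\<^sub>2 t * \<phi>\<^sub>2 v) * f u * f v)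
      = (\<lambda>u v. (f u * \<phi>\<^sub>1 u) * (f v * \<psi>\<^sub>1 t) + f u * (f v * \<phi>\<^sub>2 v * \<psi>\<^sub>2 t))" for t
    by (simp add: fun_eq_iff algebra_simps)
  moreover have "dint (\<lambda>u v. (f u * \<phi>\<^sub>1 u) * (f v * \<psi>\<^sub>1 t) + f u * (f v * \<phi>\<^sub>2 v * \<psi>\<^sub>2 t))
      = I01 f * I01 (\<lambda>t. f t * \<phi>\<^sub>1 t) * \<psi>\<^sub>1 t + I01 f * I01 (\<lambda>t. f t * \<phi>\<^sub>2 t) * \<psi>\<^sub>2 t" for t
    by (subst dint_mult_add) (auto intro!: continuous_intros assms)
  ultimately show ?thesis
    unfolding lyapunov_op_def by (simp only:)
qed

lemma I01_combination:
  assumes "continuous_on {0..1} g" "continuous_on {0..1} h"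
  shows "I01 (\<lambda>t\<in>{0..1}. x * g t + y * h t) = I01 g * x + I01 h * y"
proof -
  have "I01 (\<lambda>t\<in>{0..1}. x * g t + y * h t) = I01 (\<lambda>t. x * g t + y * h t)"
    by (rule integral_cong) simp
  also have "\<dots> = I01 g * x + I01 h * y"
    by (subst integral_add)
      (auto intro!: integrable_continuous_real continuous_intros assms)
  finally show ?thesis .
qed

lemma I01_combination_mult:
  assumes "continuous_on {0..1} g" "continuous_on {0..1} h" "continuous_on {0..1} \<phi>"
  shows "I01 (\<lambda>t. (\<lambda>t\<in>{0..1}. x * g t + y * h t) t * \<phi> t)
      = I01 (\<lambda>t. g t * \<phi> t) * x + I01 (\<lambda>t. h t * \<phi> t) * y"
proof -
  have "I01 (\<lambda>t. (\<lambda>t\<in>{0..1}. x * g t + y * h t) t * \<phi> t)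
      = I01 (\<lambda>t\<in>{0..1}. x * (g t * \<phi> t) + y * (h t * \<phi> t))"
    by (rule integral_cong) (simp add: algebra_simps)
  also have "\<dots> = I01 (\<lambda>t. g t * \<phi> t) * x + I01 (\<lambda>t. h t * \<phi> t) * y"
    by (rule I01_combination) (auto intro!: continuous_on_mult assms)
  finally show ?thesis .
qed

lemma C01_plus0_D:
  assumes "f \<in> C01_plus0"
  shows "continuous_on {0..1} f" "\<And>t. t \<in> {0..1} \<Longrightarrow> 0 \<le> f t" "f \<in> extensional {0..1}"
    "\<exists>t\<in>{0..1}. 0 < f t"
proof -
  show *: "continuous_on {0..1} f" "\<And>t. t \<in> {0..1} \<Longrightarrow> 0 \<le> f t" "f \<in> extensional {0..1}"
    using assms by (auto simp: C01_plus0_def C01_plus_def C01_def)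
  have "f \<noteq> (\<lambda>t\<in>{0..1}. 0)"
    using assms by (simp add: C01_plus0_def)
  \<comment> \<open>Extensional functions that agree on the interval are equal, so a nonzero element
    of the cone is nonzero at some point of it.\<close>
  then have "\<exists>t\<in>{0..1}. f t \<noteq> 0"
    using *(3) by (metis extensionalityI restrict_apply restrict_extensional)
  then show "\<exists>t\<in>{0..1}. 0 < f t"
    using *(2) by force
qed

section \<open>Unique fixed points of the two operators\<close>

lemma ex1_fixed_point_lyapunov_op:
  assumes C: "\<phi>\<^sub>1 \<in> C01_plus0" "\<phi>\<^sub>2 \<in> C01_plus0" "\<psi>\<^sub>1 \<in> C01_plus0" "\<psi>\<^sub>2 \<in> C01_plus0"
    and pos: "\<And>t. t \<in> {0..1} \<Longrightarrow> 0 < \<phi>\<^sub>1 t" "\<And>t. t \<in> {0..1} \<Longrightarrow> 0 < \<phi>\<^sub>2 t"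
      "\<And>t. t \<in> {0..1} \<Longrightarrow> 0 < \<psi>\<^sub>1 t" "\<And>t. t \<in> {0..1} \<Longrightarrow> 0 < \<psi>\<^sub>2 t"
  shows "\<exists>!f. f \<in> C01_plus0 \<and> lyapunov_op \<phi>\<^sub>1 \<phi>\<^sub>2 \<psi>\<^sub>1 \<psi>\<^sub>2 f = f"
proof -
  note cont = C(1-4)[THEN C01_plus0_D(1)]
  define F where "F x y = (\<lambda>t\<in>{0..1}. x * \<psi>\<^sub>1 t + y * \<psi>\<^sub>2 t)" for x y :: real
  \<comment> \<open>The quadratic operator with its components interchanged: the coefficient of
    \<psi>1 carries the weight \<phi>1, that of \<psi>2 the weight \<phi>2.\<close>
  define Q where "Q = (\<lambda>(x, y).
    ((I01 \<psi>\<^sub>1 * x + I01 \<psi>\<^sub>2 * y) * (I01 (\<lambda>t. \<psi>\<^sub>1 t * \<phi>\<^sub>1 t) * x + I01 (\<lambda>t. \<psi>\<^sub>2 t * \<phi>\<^sub>1 t) * y),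
     (I01 \<psi>\<^sub>1 * x + I01 \<psi>\<^sub>2 * y) * (I01 (\<lambda>t. \<psi>\<^sub>1 t * \<phi>\<^sub>2 t) * x + I01 (\<lambda>t. \<psi>\<^sub>2 t * \<phi>\<^sub>2 t) * y)))"
  have "\<exists>!z. z \<in> R2_plus0 \<and> Q z = z"
    unfolding Q_def
    by (rule ex1_fixed_point_linear_product)
      (auto intro!: I01_pos[of _ 0] continuous_on_mult cont mult_pos_pos pos less_imp_le)
  then obtain x\<^sub>0 y\<^sub>0 where z: "(x\<^sub>0, y\<^sub>0) \<in> R2_plus0" "Q (x\<^sub>0, y\<^sub>0) = (x\<^sub>0, y\<^sub>0)"
    and unique: "\<And>x y. (x, y) \<in> R2_plus0 \<Longrightarrow> Q (x, y) = (x, y) \<Longrightarrow> x = x\<^sub>0 \<and> y = y\<^sub>0"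
    by (elim ex1E) (metis prod.exhaust prod.inject)
  have contF: "continuous_on {0..1} (F x y)" for x y
    unfolding F_def
    by (subst continuous_on_cong[OF refl restrict_apply']) (auto intro!: continuous_intros cont)
  \<comment> \<open>Together with \<open>lyap\<close>, this says that the Lyapunov operator takes
    the combination with coefficients \<open>(x, y)\<close> to the one with coefficients
    \<open>Q (x, y)\<close>.\<close>
  have QF: "Q (x, y) = (I01 (F x y) * I01 (\<lambda>t. F x y t * \<phi>\<^sub>1 t), I01 (F x y) * I01 (\<lambda>t. F x y t * \<phi>\<^sub>2 t))"
    for x y
    unfolding Q_def F_def
    by (simp only: I01_combination I01_combination_mult cont prod.case)
  have lyap: "lyapunov_op \<phi>\<^sub>1 \<phi>\<^sub>2 \<psi>\<^sub>1 \<psi>\<^sub>2 f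
      = F (I01 f * I01 (\<lambda>t. f t * \<phi>\<^sub>1 t)) (I01 f * I01 (\<lambda>t. f t * \<phi>\<^sub>2 t))"
    if "continuous_on {0..1} f" for f
    unfolding F_def by (rule lyapunov_op_eq) (use cont that in auto)
  show ?thesis
  proof (rule ex1I[of _ "F x\<^sub>0 y\<^sub>0"], intro conjI)
    have nn: "0 \<le> x\<^sub>0" "0 \<le> y\<^sub>0" "0 < x\<^sub>0 \<or> 0 < y\<^sub>0"
      using z(1) by (auto simp: R2_plus0_def)
    have pos_F: "0 < F x\<^sub>0 y\<^sub>0 t" if "t \<in> {0..1}" for t
      using nn pos(3,4)[OF that] that
      by (auto simp: F_def intro: add_pos_nonneg add_nonneg_pos)
    have "F x\<^sub>0 y\<^sub>0 \<noteq> (\<lambda>t\<in>{0..1}. 0)"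
      using pos_F[of 0] by (auto dest: fun_cong[of _ _ 0])
    moreover have "\<forall>t\<in>{0..1}. 0 \<le> F x\<^sub>0 y\<^sub>0 t"
      using pos_F by (simp add: less_imp_le)
    moreover have "F x\<^sub>0 y\<^sub>0 \<in> extensional {0..1}"
      by (simp add: F_def)
    ultimately show "F x\<^sub>0 y\<^sub>0 \<in> C01_plus0"
      using contF by (simp add: C01_plus0_def C01_plus_def C01_def)
    show "lyapunov_op \<phi>\<^sub>1 \<phi>\<^sub>2 \<psi>\<^sub>1 \<psi>\<^sub>2 (F x\<^sub>0 y\<^sub>0) = F x\<^sub>0 y\<^sub>0"
      using lyap[OF contF] QF z(2) by simp
  next
    fix f
    assume f: "f \<in> C01_plus0 \<and> lyapunov_op \<phi>\<^sub>1 \<phi>\<^sub>2 \<psi>\<^sub>1 \<psi>\<^sub>2 f = f"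
    \<comment> \<open>The coefficients are read off from integrals of \<open>f\<close>; the
      representation by \<psi>1 and \<psi>2 would not determine them if these functions were
      proportional.\<close>
    define x where "x = I01 f * I01 (\<lambda>t. f t * \<phi>\<^sub>1 t)"
    define y where "y = I01 f * I01 (\<lambda>t. f t * \<phi>\<^sub>2 t)"
    note fD = C01_plus0_D[OF conjunct1[OF f]]
    have fF: "f = F x y"
      using lyap[OF fD(1)] f unfolding x_def y_def by metis
    obtain t where t: "t \<in> {0..1}" "0 < f t"
      using fD(4) by blast
    have pos_mult: "0 < I01 (\<lambda>s. f s * \<phi> s)"
      if "continuous_on {0..1} \<phi>" "\<And>s. s \<in> {0..1} \<Longrightarrow> 0 < \<phi> s" for \<phi>
      by (rule I01_pos[OF _ _ t(1)])
        (use that fD t in \<open>auto intro!: continuous_on_mult simp: less_imp_le\<close>)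
    have "0 < I01 f"
      by (rule I01_pos[OF fD(1,2) t])
    moreover have "0 < I01 (\<lambda>t. f t * \<phi>\<^sub>1 t)"
      by (rule pos_mult[OF cont(1) pos(1)])
    moreover have "0 < I01 (\<lambda>t. f t * \<phi>\<^sub>2 t)"
      by (rule pos_mult[OF cont(2) pos(2)])
    ultimately have "(x, y) \<in> R2_plus0"
      by (simp add: R2_plus0_def x_def y_def)
    moreover have "Q (x, y) = (x, y)"
      unfolding QF fF[symmetric] by (simp add: x_def y_def)
    ultimately show "f = F x\<^sub>0 y\<^sub>0"
      using unique fF by blast
  qed
qed

text \<open>In factored form this is again a positive linear form times a positive matrix, with the
  rows in the opposite order from \<open>Q\<close> above.\<close>

lemma ex1_fixed_point_quadratic_op:
  assumes C: "\<phi>\<^sub>1 \<in> C01_plus0" "\<phi>\<^sub>2 \<in> C01_plus0" "\<psi>\<^sub>1 \<in> C01_plus0" "\<psi>\<^sub>2 \<in> C01_plus0"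
    and pos: "\<And>t. t \<in> {0..1} \<Longrightarrow> 0 < \<phi>\<^sub>1 t" "\<And>t. t \<in> {0..1} \<Longrightarrow> 0 < \<phi>\<^sub>2 t"
      "\<And>t. t \<in> {0..1} \<Longrightarrow> 0 < \<psi>\<^sub>1 t" "\<And>t. t \<in> {0..1} \<Longrightarrow> 0 < \<psi>\<^sub>2 t"
  shows "\<exists>!z. z \<in> R2_plus0 \<and> quadratic_op \<phi>\<^sub>1 \<phi>\<^sub>2 \<psi>\<^sub>1 \<psi>\<^sub>2 z = z"
proof -
  note cont = C(1-4)[THEN C01_plus0_D(1)]
  show ?thesis
    unfolding quadratic_op_eq[OF cont]
    by (rule ex1_fixed_point_linear_product)
      (auto intro!: I01_pos[of _ 0] continuous_on_mult cont mult_pos_pos pos less_imp_le)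
qed

theorem lemma2p2:
  fixes \<phi>\<^sub>1 \<phi>\<^sub>2 \<psi>\<^sub>1 \<psi>\<^sub>2 :: "real \<Rightarrow> real"
  assumes "\<phi>\<^sub>1 \<in> C01_plus0" and "\<phi>\<^sub>2 \<in> C01_plus0"
    and "\<psi>\<^sub>1 \<in> C01_plus0" and "\<psi>\<^sub>2 \<in> C01_plus0"
    and "\<And>t. t \<in> {0..1} \<Longrightarrow> 0 < \<phi>\<^sub>1 t" and "\<And>t. t \<in> {0..1} \<Longrightarrow> 0 < \<phi>\<^sub>2 t"
    and "\<And>t. t \<in> {0..1} \<Longrightarrow> 0 < \<psi>\<^sub>1 t" and "\<And>t. t \<in> {0..1} \<Longrightarrow> 0 < \<psi>\<^sub>2 t"
  shows "((\<exists>f\<in>C01_plus0. lyapunov_op \<phi>\<^sub>1 \<phi>\<^sub>2 \<psi>\<^sub>1 \<psi>\<^sub>2 f = f) \<longleftrightarrow>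
            (\<exists>p\<in>R2_plus0. quadratic_op \<phi>\<^sub>1 \<phi>\<^sub>2 \<psi>\<^sub>1 \<psi>\<^sub>2 p = p)) \<and>
         fixed_points C01_plus0 (lyapunov_op \<phi>\<^sub>1 \<phi>\<^sub>2 \<psi>\<^sub>1 \<psi>\<^sub>2) \<approx>
           fixed_points R2_plus0 (quadratic_op \<phi>\<^sub>1 \<phi>\<^sub>2 \<psi>\<^sub>1 \<psi>\<^sub>2)"
proof -
  obtain f where f: "\<And>g. g \<in> C01_plus0 \<and> lyapunov_op \<phi>\<^sub>1 \<phi>\<^sub>2 \<psi>\<^sub>1 \<psi>\<^sub>2 g = g \<longleftrightarrow> g = f"
    using ex1_fixed_point_lyapunov_op[OF assms] by (metis (no_types))
  obtain z where z: "\<And>w. w \<in> R2_plus0 \<and> quadratic_op \<phi>\<^sub>1 \<phi>\<^sub>2 \<psi>\<^sub>1 \<psi>\<^sub>2 w = w \<longleftrightarrow> w = z"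
    using ex1_fixed_point_quadratic_op[OF assms] by (metis (no_types))
  \<comment> \<open>Both fixed-point sets are singletons, so both existence claims hold and the sets
    are equipollent, without relating one fixed point to the other.\<close>
  have "fixed_points C01_plus0 (lyapunov_op \<phi>\<^sub>1 \<phi>\<^sub>2 \<psi>\<^sub>1 \<psi>\<^sub>2) = {f}"
    "fixed_points R2_plus0 (quadratic_op \<phi>\<^sub>1 \<phi>\<^sub>2 \<psi>\<^sub>1 \<psi>\<^sub>2) = {z}"
    unfolding fixed_points_def f z by simp_all
  then show ?thesis
    using f[of f] z[of z] by (metis singleton_eqpoll)
qed

end
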